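(* Let $\varphi=\frac{1+\sqrt5}{2}$. Consider a position of the game Peer Pressure in which Alice has $a$ cards and Bob has $b$ cards. (1) If $a>\varphi b$, then Alice has a winning strategy. (2) If $b<\varphi a$ and every card of Alice is higher than every card of Bob, then Alice has a winning strategy.
   Context: Peer Pressure. There are two players, Alice and Bob. A position consists of two disjoint finite sets of integers, Alice's hand and Bob's hand, not both empty (each integer is a card, and the integers are distinct). In each round (battle) the players simultaneously each choose one card from their own hand and play it. The player who played the higher card wins the round and takes the lower card into his or her hand; the higher card is permanently discarded from the game. Thus in each round the winner's number of cards is unchanged and the loser's decreases by one. The player who runs out of cards loses (in particular, if Bob's hand is empty then Alice has won). Both players know the contents of both hands at all times. Strategies. A pure strategy for a player assigns a card to play to each history of play (the initial hands and the cards played by both players in the previous rounds); the choice in a round cannot depend on the opponent's simultaneous choice. A mixed strategy is a probability distribution over pure strategies. A player has a winning strategy at a position if there is a strategy (possibly mixed) which she may announce in advance and with which she still always wins against every strategy of the opponent. If such a strategy exists, then a pure one also exists. *)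

theory Defs
  imports Complex_Main "HOL-Probability.Probability_Mass_Function"
begin

text \<open>A pair is always ordered as (Alice, Bob): hands in a position, cards in a round.\<close>

type_synonym position = "int set \<times> int set"
type_synonym plays = "(int \<times> int) list"
type_synonym history = "position \<times> plays"
type_synonym pure_strategy = "history \<Rightarrow> int"

definition is_position :: "position \<Rightarrow> bool" where
  "is_position p \<longleftrightarrow>
     finite (fst p) \<and> finite (snd p) \<and> fst p \<inter> snd p = {} \<and> (fst p \<noteq> {} \<or> snd p \<noteq> {})"

fun battle :: "position \<Rightarrow> int \<times> int \<Rightarrow> position" where
  "battle (A, B) (x, y) =
     (if y < x then (insert y (A - {x}), B - {y}) else (A - {x}, insert x (B - {y})))"

text \<open>The plays are listed from the first round to the last.\<close>

definition hands_after :: "history \<Rightarrow> position" where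
  "hands_after h = foldl battle (fst h) (snd h)"

fun legal_plays :: "position \<Rightarrow> plays \<Rightarrow> bool" where
  "legal_plays p [] \<longleftrightarrow> True"
| "legal_plays p (r # rs) \<longleftrightarrow> fst r \<in> fst p \<and> snd r \<in> snd p \<and> legal_plays (battle p r) rs"

definition game_over :: "position \<Rightarrow> bool" where
  "game_over p \<longleftrightarrow> fst p = {} \<or> snd p = {}"

definition unfinished_history :: "history \<Rightarrow> bool" where
  "unfinished_history h \<longleftrightarrow>
     is_position (fst h) \<and> legal_plays (fst h) (snd h) \<and> \<not> game_over (hands_after h)"

text \<open>Values of a strategy on arguments that are not unfinished histories are irrelevant.\<close>

definition alice_pure :: "pure_strategy \<Rightarrow> bool" where
  "alice_pure s \<longleftrightarrow> (\<forall>h. unfinished_history h \<longrightarrow> s h \<in> fst (hands_after h))"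

definition bob_pure :: "pure_strategy \<Rightarrow> bool" where
  "bob_pure t \<longleftrightarrow> (\<forall>h. unfinished_history h \<longrightarrow> t h \<in> snd (hands_after h))"

fun play_out :: "pure_strategy \<Rightarrow> pure_strategy \<Rightarrow> position \<Rightarrow> nat \<Rightarrow> history" where
  "play_out s t p 0 = (p, [])"
| "play_out s t p (Suc n) =
     (let h = play_out s t p n in
      if game_over (hands_after h) then h else (p, snd h @ [(s h, t h)]))"

definition alice_wins :: "pure_strategy \<Rightarrow> pure_strategy \<Rightarrow> position \<Rightarrow> bool" where
  "alice_wins s t p \<longleftrightarrow> (\<exists>n. snd (hands_after (play_out s t p n)) = {})"

text \<open>
  Mixed strategies are discrete distributions over pure strategies. This loses nothing: from a
  given position only finitely many histories can arise, with finitely many choices at each.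
  The two players randomise independently, hence the product distribution below.
\<close>

definition alice_mixed :: "pure_strategy pmf \<Rightarrow> bool" where
  "alice_mixed \<sigma> \<longleftrightarrow> (\<forall>s\<in>set_pmf \<sigma>. alice_pure s)"

definition bob_mixed :: "pure_strategy pmf \<Rightarrow> bool" where
  "bob_mixed \<tau> \<longleftrightarrow> (\<forall>t\<in>set_pmf \<tau>. bob_pure t)"

definition alice_has_winning_strategy :: "position \<Rightarrow> bool" where
  "alice_has_winning_strategy p \<longleftrightarrow>
     (\<exists>\<sigma>. alice_mixed \<sigma> \<and>
        (\<forall>\<tau>. bob_mixed \<tau> \<longrightarrow> (AE (s, t) in measure_pmf (pair_pmf \<sigma> \<tau>). alice_wins s t p)))"

definition golden_ratio :: real where
  "golden_ratio = (1 + sqrt 5) / 2"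

end

theory Submission
  imports Defs
begin

text \<open>
  Write \<open>\<phi>\<close> for the golden ratio, so that \<open>\<phi>\<^sup>2 = \<phi> + 1\<close> and \<open>\<phi>\<^sup>3 = \<phi>\<^sup>2 + \<phi>\<close>.
  Informally, when all of Alice's cards are high she plays each of them once, Bob can only pay with
  his low cards, and afterwards she holds more than \<open>\<phi>\<close> times as many cards as he does. When on the
  other hand she has more than \<open>\<phi>\<close> times as many cards, she gives away her lowest cards in exchange
  for Bob's highest ones, until all that she still has is high. The two parts of the theorem thus
  reduce to each other.

  Bob may mix the two kinds of replies, and a single potential covers both phases. Relative to a
  threshold \<open>x\<close>, each card of Alice counts \<open>\<phi>\<^sup>2\<close> if it is at least \<open>x\<close> and \<open>1\<close> otherwise,
  while each card of Bob counts against her, with \<open>\<phi>\<close> if it is below \<open>x\<close> and \<open>\<phi>\<^sup>3\<close> otherwise.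
  If Alice plays the card \<open>x\<close> and moves the threshold just above \<open>x\<close>, then whatever Bob plays the
  potential does not change (\<open>advantage_battle\<close>): she loses \<open>\<phi>\<^sup>2\<close>, and either Bob's low card
  becomes a low card of hers, worth \<open>\<phi> + 1\<close> to her, or a high card of Bob is replaced by the low
  card \<open>x\<close>, worth \<open>\<phi>\<^sup>3 - \<phi>\<close>. If the potential is positive, then Alice can move the threshold to one
  of her own cards without making it nonpositive: up to her next card, or, when she has used up all
  cards above the threshold, down to her lowest one (\<open>favourable_if_advantage\<close>). So she can go on
  until the game ends, and it cannot end in her defeat because the potential of an empty hand is not
  positive. Either hypothesis of the theorem makes the potential positive when the threshold
  is the lowest card of Alice.
\<close>

section \<open>The potential\<close>

lemma golden_ratio_gt_1: "1 < golden_ratio"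
proof -
  have "1 < sqrt 5"
    by (rule real_less_rsqrt) simp
  thus ?thesis
    by (simp add: golden_ratio_def)
qed

lemma golden_ratio_square: "golden_ratio\<^sup>2 = golden_ratio + 1"
  by (simp add: golden_ratio_def power2_eq_square field_simps)

lemma golden_ratio_cube: "golden_ratio ^ 3 = golden_ratio\<^sup>2 + golden_ratio"
proof -
  have "golden_ratio ^ 3 = golden_ratio * golden_ratio\<^sup>2"
    by (simp add: power3_eq_cube power2_eq_square)
  thus ?thesis
    by (simp add: golden_ratio_square algebra_simps power2_eq_square[symmetric])
qed

lemma golden_ratio_le_cube: "golden_ratio \<le> golden_ratio ^ 3"
  by (simp add: golden_ratio_cube)

definition alice_weight :: "int \<Rightarrow> int \<Rightarrow> real" where
  "alice_weight x a = (if x \<le> a then golden_ratio\<^sup>2 else 1)"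

definition bob_weight :: "int \<Rightarrow> int \<Rightarrow> real" where
  "bob_weight x b = (if x \<le> b then golden_ratio ^ 3 else golden_ratio)"

definition advantage :: "int \<Rightarrow> int set \<Rightarrow> int set \<Rightarrow> real" where
  "advantage x A B = sum (alice_weight x) A - sum (bob_weight x) B"

definition favourable :: "position \<Rightarrow> bool" where
  "favourable p \<longleftrightarrow> (\<exists>x\<in>fst p. 0 < advantage x (fst p) (snd p))"

lemma bob_weight_bounds: "golden_ratio \<le> bob_weight x b" "bob_weight x b \<le> golden_ratio ^ 3"
  using golden_ratio_le_cube by (auto simp: bob_weight_def)

lemma bob_sum_bounds:
  "golden_ratio * card B \<le> sum (bob_weight x) B"
  "sum (bob_weight x) B \<le> golden_ratio ^ 3 * card B"
  using sum_bounded_below[of B golden_ratio "bob_weight x"]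
    sum_bounded_above[of B "bob_weight x" "golden_ratio ^ 3"] bob_weight_bounds
  by (simp_all add: mult.commute)

text \<open>Raising the threshold past no card of Alice can only make cards of Bob cheaper.\<close>

lemma advantage_mono:
  assumes "t \<le> x" "\<And>a. a \<in> A \<Longrightarrow> t \<le> a \<Longrightarrow> x \<le> a"
  shows "advantage t A B \<le> advantage x A B"
proof -
  have "sum (alice_weight t) A = sum (alice_weight x) A"
    by (rule sum.cong) (use assms in \<open>force simp: alice_weight_def\<close>)+
  moreover have "sum (bob_weight x) B \<le> sum (bob_weight t) B"
    by (rule sum_mono) (use assms(1) golden_ratio_le_cube in \<open>auto simp: bob_weight_def\<close>)
  ultimately show ?thesis
    by (simp add: advantage_def)
qed

lemma advantage_Min:
  assumes "finite A"
  shows "golden_ratio\<^sup>2 * card A - sum (bob_weight (Min A)) B = advantage (Min A) A B"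
proof -
  have "sum (alice_weight (Min A)) A = sum (\<lambda>_. golden_ratio\<^sup>2) A"
    by (rule sum.cong) (use assms in \<open>auto simp: alice_weight_def\<close>)
  thus ?thesis
    by (simp add: advantage_def)
qed

text \<open>
  With the threshold at her lowest card Alice needs \<open>\<phi>\<^sup>2 |A| > \<phi>\<^sup>3 |B|\<close> in the worst case.
\<close>

lemma favourable_if_many_cards:
  assumes "finite A" "golden_ratio * card B < card A"
  shows "favourable (A, B)"
proof -
  have "0 \<le> golden_ratio * card B"
    using golden_ratio_gt_1 by simp
  hence "card A \<noteq> 0"
    using assms(2) by auto
  hence "A \<noteq> {}"
    by auto
  have "golden_ratio\<^sup>2 * (golden_ratio * card B) < golden_ratio\<^sup>2 * card A"
    by (rule mult_strict_left_mono[OF assms(2)]) (use golden_ratio_gt_1 in simp)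
  hence "golden_ratio ^ 3 * card B < golden_ratio\<^sup>2 * card A"
    by (simp add: power3_eq_cube power2_eq_square mult.assoc)
  hence "0 < advantage (Min A) A B"
    using bob_sum_bounds(2)[of "Min A" B] advantage_Min[OF assms(1), of B] by linarith
  thus ?thesis
    using Min_in[OF assms(1) \<open>A \<noteq> {}\<close>] by (auto simp: favourable_def)
qed

lemma favourable_if_high_cards:
  assumes "finite A" "card B < golden_ratio * card A" "\<forall>x\<in>A. \<forall>y\<in>B. y < x"
  shows "favourable (A, B)"
proof -
  have "A \<noteq> {}"
    using assms(2) by auto
  hence Min: "Min A \<in> A"
    using assms(1) by simp
  have "sum (bob_weight (Min A)) B = sum (\<lambda>_. golden_ratio) B"
    by (rule sum.cong) (use assms(3) Min in \<open>force simp: bob_weight_def\<close>)+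
  moreover have "golden_ratio * card B < golden_ratio * (golden_ratio * card A)"
    by (rule mult_strict_left_mono[OF assms(2)]) (use golden_ratio_gt_1 in simp)
  ultimately have "0 < advantage (Min A) A B"
    using advantage_Min[OF assms(1), of B] by (simp add: power2_eq_square mult.assoc mult.commute)
  thus ?thesis
    using Min by (auto simp: favourable_def)
qed

text \<open>
  The potential at an arbitrary threshold is enough. If Alice has no card left above it, each of
  her cards counts only \<open>1\<close>, so that she has more than \<open>\<phi>\<close> times as many cards as Bob and may
  start afresh with her lowest card.
\<close>

lemma favourable_if_advantage:
  assumes "finite A" "0 < advantage t A B"
  shows "favourable (A, B)"
proof (cases "{a \<in> A. t \<le> a} = {}")
  case True
  have "sum (alice_weight t) A = sum (\<lambda>_. 1) A"
    by (rule sum.cong) (use True in \<open>auto simp: alice_weight_def\<close>)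
  hence "golden_ratio * card B < card A"
    using assms(2) bob_sum_bounds(1)[of B t] by (simp add: advantage_def)
  thus ?thesis
    by (rule favourable_if_many_cards[OF assms(1)])
next
  case False
  define x where "x = Min {a \<in> A. t \<le> a}"
  have x: "x \<in> A" "t \<le> x"
    using Min_in[OF _ False] assms(1) by (auto simp: x_def)
  have "advantage t A B \<le> advantage x A B"
    by (rule advantage_mono) (use x assms(1) in \<open>auto simp: x_def\<close>)
  thus ?thesis
    using assms(2) x(1) unfolding favourable_def by (intro bexI[of _ x]) auto
qed

section \<open>One round\<close>

text \<open>
  All cards that stay where they are differ from \<open>x\<close> and so keep their weights when the threshold
  moves from \<open>x\<close> to \<open>x + 1\<close>; the cards that move balance because of
  \<open>\<phi>\<^sup>2 = \<phi> + 1\<close> if Alice wins the round and \<open>\<phi>\<^sup>3 = \<phi>\<^sup>2 + \<phi>\<close> if Bob does.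
\<close>

lemma advantage_battle:
  assumes "finite A" "finite B" "A \<inter> B = {}" "x \<in> A" "y \<in> B"
    and "battle (A, B) (x, y) = (A', B')"
  shows "advantage (x + 1) A' B' = advantage x A B"
proof -
  have notin: "x \<notin> B" "y \<notin> A" "x \<noteq> y"
    using assms(3-5) by auto
  have A: "sum (alice_weight x) A = golden_ratio\<^sup>2 + sum (alice_weight (x + 1)) (A - {x})"
  proof -
    have "sum (alice_weight x) (A - {x}) = sum (alice_weight (x + 1)) (A - {x})"
      by (rule sum.cong) (auto simp: alice_weight_def)
    thus ?thesis
      using assms(1,4) by (simp add: sum.remove alice_weight_def)
  qed
  have B: "sum (bob_weight x) B = bob_weight x y + sum (bob_weight (x + 1)) (B - {y})"
  proof -
    have "bob_weight x b = bob_weight (x + 1) b" if "b \<in> B" for b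
    proof -
      have "b \<noteq> x"
        using that notin(1) by auto
      hence "x \<le> b \<longleftrightarrow> x + 1 \<le> b"
        by linarith
      thus ?thesis
        by (simp add: bob_weight_def)
    qed
    hence "sum (bob_weight x) (B - {y}) = sum (bob_weight (x + 1)) (B - {y})"
      by (intro sum.cong) auto
    thus ?thesis
      using assms(2,5) by (simp add: sum.remove)
  qed
  show ?thesis
  proof (cases "y < x")
    case True
    hence "A' = insert y (A - {x})" "B' = B - {y}"
      using assms(6) by auto
    hence "advantage (x + 1) A' B' =
        1 + sum (alice_weight (x + 1)) (A - {x}) - sum (bob_weight (x + 1)) (B - {y})"
      using assms(1) notin True by (simp add: advantage_def alice_weight_def)
    thus ?thesis
      using A B True by (simp add: advantage_def bob_weight_def golden_ratio_square)
  next
    case False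
    hence "A' = A - {x}" "B' = insert x (B - {y})"
      using assms(6) by auto
    hence "advantage (x + 1) A' B' =
        sum (alice_weight (x + 1)) (A - {x})
          - (golden_ratio + sum (bob_weight (x + 1)) (B - {y}))"
      using assms(2) notin by (simp add: advantage_def bob_weight_def)
    thus ?thesis
      using A B False by (simp add: advantage_def bob_weight_def golden_ratio_cube)
  qed
qed

lemma is_position_battle:
  assumes "is_position p" "x \<in> fst p" "y \<in> snd p"
  shows "is_position (battle p (x, y))"
  using assms by (cases p) (auto simp: is_position_def)

lemma card_battle:
  assumes "is_position p" "x \<in> fst p" "y \<in> snd p"
  shows "Suc (card (fst (battle p (x, y))) + card (snd (battle p (x, y))))
    = card (fst p) + card (snd p)"
proof -
  obtain A B where p: "p = (A, B)"
    by force
  have "finite A" "finite B" "x \<in> A" "y \<in> B" "x \<notin> B" "y \<notin> A"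
    using assms by (auto simp: p is_position_def)
  thus ?thesis
    using card_Suc_Diff1[of A x] card_Suc_Diff1[of B y] by (simp add: p)
qed

lemma favourable_battle:
  assumes "is_position p" "x \<in> fst p" "0 < advantage x (fst p) (snd p)" "y \<in> snd p"
  shows "favourable (battle p (x, y))"
proof -
  obtain A B A' B' where p: "p = (A, B)" and p': "battle p (x, y) = (A', B')"
    by (metis surj_pair)
  have "0 < advantage (x + 1) A' B'"
    using assms p' advantage_battle[of A B x y A' B'] by (simp add: p is_position_def)
  moreover have "finite A'"
    using is_position_battle[OF assms(1,2,4)] by (simp add: p' is_position_def)
  ultimately show ?thesis
    using favourable_if_advantage by (simp add: p')
qed

section \<open>Playing the game\<close>

text \<open>
  The second branch only serves to give a legal card in positions that the strategy never reaches
  from a favourable one.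
\<close>

definition threshold_strategy :: pure_strategy where
  "threshold_strategy h =
     (let p = hands_after h in
      if favourable p then SOME x. x \<in> fst p \<and> 0 < advantage x (fst p) (snd p)
      else SOME x. x \<in> fst p)"

lemma threshold_strategy_favourable:
  assumes "hands_after h = p" "favourable p"
  shows "threshold_strategy h \<in> fst p" "0 < advantage (threshold_strategy h) (fst p) (snd p)"
proof -
  have "\<exists>x. x \<in> fst p \<and> 0 < advantage x (fst p) (snd p)"
    using assms(2) by (auto simp: favourable_def)
  from someI_ex[OF this]
  show "threshold_strategy h \<in> fst p" "0 < advantage (threshold_strategy h) (fst p) (snd p)"
    using assms by (simp_all add: threshold_strategy_def)
qed

lemma alice_pure_threshold_strategy: "alice_pure threshold_strategy"
  unfolding alice_pure_def
proof (intro allI impI)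
  fix h assume "unfinished_history h"
  hence nonempty: "fst (hands_after h) \<noteq> {}"
    by (simp add: unfinished_history_def game_over_def)
  show "threshold_strategy h \<in> fst (hands_after h)"
  proof (cases "favourable (hands_after h)")
    case True
    thus ?thesis
      by (rule threshold_strategy_favourable(1)[OF refl])
  next
    case False
    thus ?thesis
      using nonempty by (simp add: threshold_strategy_def some_in_eq)
  qed
qed

lemma legal_plays_snoc:
  "legal_plays p (rs @ [r]) \<longleftrightarrow>
     legal_plays p rs \<and> fst r \<in> fst (foldl battle p rs) \<and> snd r \<in> snd (foldl battle p rs)"
  by (induction rs arbitrary: p) auto

text \<open>
  Every round removes one card from the game, so the bound on the number of cards limits the
  number of rounds for which Bob can keep a nonempty hand.
\<close>

lemma play_out_invariant:
  assumes "is_position p" "favourable p" "bob_pure t"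
    and "\<And>n. snd (hands_after (play_out threshold_strategy t p n)) \<noteq> {}"
  shows "let h = play_out threshold_strategy t p n; q = hands_after h in
    fst h = p \<and> legal_plays p (snd h) \<and> is_position q \<and> favourable q \<and>
    card (fst q) + card (snd q) + n = card (fst p) + card (snd p)"
proof (induction n)
  case 0
  show ?case
    using assms(1,2) by (simp add: hands_after_def)
next
  case (Suc n)
  define h where "h = play_out threshold_strategy t p n"
  define q where "q = hands_after h"
  define x where "x = threshold_strategy h"
  define y where "y = t h"
  have h: "fst h = p" "legal_plays p (snd h)" and q: "is_position q" "favourable q"
    and card_q: "card (fst q) + card (snd q) + n = card (fst p) + card (snd p)"
    using Suc.IH by (simp_all add: h_def q_def Let_def)
  have x: "x \<in> fst q" "0 < advantage x (fst q) (snd q)"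
    unfolding x_def by (intro threshold_strategy_favourable; simp add: q_def[symmetric] q(2))+
  have "snd q \<noteq> {}"
    using assms(4) by (simp add: q_def h_def)
  hence "\<not> game_over q"
    using x(1) by (auto simp: game_over_def)
  hence y: "y \<in> snd q"
    using assms(1,3) h \<open>\<not> game_over q\<close>
    unfolding bob_pure_def unfinished_history_def y_def q_def by blast
  have h': "play_out threshold_strategy t p (Suc n) = (p, snd h @ [(x, y)])"
    using \<open>\<not> game_over q\<close> by (simp add: h_def q_def x_def y_def Let_def)
  have q_foldl: "q = foldl battle p (snd h)"
    using h(1) by (simp add: q_def hands_after_def)
  have q': "hands_after (p, snd h @ [(x, y)]) = battle q (x, y)"
    by (simp add: hands_after_def q_foldl)
  have "legal_plays p (snd h @ [(x, y)])"
    using h(2) x(1) y by (simp add: legal_plays_snoc q_foldl)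
  moreover have "is_position (battle q (x, y))"
    by (rule is_position_battle[OF q(1) x(1) y])
  moreover have "favourable (battle q (x, y))"
    by (rule favourable_battle[OF q(1) x y])
  moreover have "Suc (card (fst (battle q (x, y))) + card (snd (battle q (x, y))))
      = card (fst q) + card (snd q)"
    by (rule card_battle[OF q(1) x(1) y])
  ultimately show ?case
    using card_q unfolding h' Let_def q' by simp
qed

lemma threshold_strategy_wins:
  assumes "is_position p" "favourable p" "bob_pure t"
  shows "alice_wins threshold_strategy t p"
proof (rule ccontr)
  assume "\<not> alice_wins threshold_strategy t p"
  hence "snd (hands_after (play_out threshold_strategy t p n)) \<noteq> {}" for n
    by (auto simp: alice_wins_def)
  from play_out_invariant[OF assms this, of "Suc (card (fst p) + card (snd p))"]
  show False
    by (simp add: Let_def)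
qed

lemma winning_if_favourable:
  assumes "is_position p" "favourable p"
  shows "alice_has_winning_strategy p"
  unfolding alice_has_winning_strategy_def
proof (intro exI[of _ "return_pmf threshold_strategy"] conjI allI impI)
  show "alice_mixed (return_pmf threshold_strategy)"
    by (simp add: alice_mixed_def alice_pure_threshold_strategy)
next
  fix \<tau> assume "bob_mixed \<tau>"
  thus "AE (s, t) in measure_pmf (pair_pmf (return_pmf threshold_strategy) \<tau>). alice_wins s t p"
    using threshold_strategy_wins[OF assms] by (auto simp: AE_measure_pmf_iff bob_mixed_def)
qed

section \<open>The golden ratio theorem\<close>

theorem mainTheorem2:
  fixes A B :: "int set"
  assumes "is_position (A, B)"
  shows "(real (card A) > golden_ratio * real (card B) \<longrightarrow> alice_has_winning_strategy (A, B)) \<and>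
         (real (card B) < golden_ratio * real (card A) \<and> (\<forall>x\<in>A. \<forall>y\<in>B. y < x)
            \<longrightarrow> alice_has_winning_strategy (A, B))"
proof -
  have "finite A"
    using assms by (simp add: is_position_def)
  thus ?thesis
    using winning_if_favourable[OF assms] favourable_if_many_cards favourable_if_high_cards
    by blast
qed

end
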